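(* Let $n,k\ge 1$ be integers and let $A_1,\dots,A_n$ be complex $k\times k$ matrices. Suppose that $X_1,\dots,X_n$ are independent complex $k\times k$ matrices, each of which is a solution of the matrix equation $X^n+A_1X^{n-1}+\dots+A_n=0$. Then $$\operatorname{tr} A_1=-(\operatorname{tr} X_1+\dots+\operatorname{tr} X_n),\qquad \det A_n=(-1)^{nk}\det X_1\cdots\det X_n.$$
   Context: Complex $k\times k$ matrices $X_1,\dots,X_n$ are called independent if the block Vandermonde determinant is nonzero, i.e. if the $nk\times nk$ complex matrix $$\begin{pmatrix} I & I & \dots & I\\ X_1 & X_2 & \dots & X_n\\ \vdots & \vdots & & \vdots\\ X_1^{n-1} & X_2^{n-1} & \dots & X_n^{n-1}\end{pmatrix}$$ has nonzero determinant, where $I$ is the $k\times k$ identity matrix. *)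

theory Defs
  imports Complex_Main "Jordan_Normal_Form.Determinant"
begin

definition mat_trace :: "'a :: comm_monoid_add mat \<Rightarrow> 'a" where
  "mat_trace M = (\<Sum>i<dim_row M. M $$ (i, i))"

(* Families X_1, ..., X_n are functions on nat, of which only the values at 1..n matter.
   Rows and columns are counted from 0, in n consecutive blocks of length k: row r lies in the
   block of the power r div k, column c in the block of the matrix with number c div k + 1. *)
definition block_vandermonde :: "nat \<Rightarrow> nat \<Rightarrow> (nat \<Rightarrow> complex mat) \<Rightarrow> complex mat" where
  "block_vandermonde n k X =
     mat (n * k) (n * k) (\<lambda>(r, c). (X (c div k + 1) ^\<^sub>m (r div k)) $$ (r mod k, c mod k))"

lemma block_vandermonde_index:
  assumes "a < n" "b < n" "r < k" "c < k"
  shows "block_vandermonde n k X $$ (a * k + r, b * k + c) = (X (b + 1) ^\<^sub>m a) $$ (r, c)"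
proof -
  have "a * k + r < n * k" if "a < n" "r < k" for a r
  proof -
    have "a * k + r < (a + 1) * k" using that by simp
    also have "\<dots> \<le> n * k" using that by (intro mult_right_mono) auto
    finally show ?thesis .
  qed
  then show ?thesis using assms by (simp add: block_vandermonde_def)
qed

definition independent_mats :: "nat \<Rightarrow> nat \<Rightarrow> (nat \<Rightarrow> complex mat) \<Rightarrow> bool" where
  "independent_mats n k X \<longleftrightarrow> det (block_vandermonde n k X) \<noteq> 0"

(* Y^n + A_1 Y^(n-1) + ... + A_n = 0.  Addition of matrices is not a monoid on the type of
   matrices of all sizes, so the sum is taken in the additive group of k x k matrices. *)
definition solves_matrix_equation ::
    "nat \<Rightarrow> nat \<Rightarrow> (nat \<Rightarrow> complex mat) \<Rightarrow> complex mat \<Rightarrow> bool" where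
  "solves_matrix_equation n k A Y \<longleftrightarrow>
     Y ^\<^sub>m n + (\<Oplus>\<^bsub>module_mat TYPE(complex) k k\<^esub>j\<in>{1..n}. A j * Y ^\<^sub>m (n - j)) = 0\<^sub>m k k"

end

theory Submission
  imports Defs
begin

text \<open>
  Let \<open>C\<close> be the block companion matrix of the equation, \<open>V\<close> the block Vandermonde matrix and
  \<open>D\<close> the block diagonal matrix of the solutions. The equations for \<open>X\<^sub>1, \<dots>, X\<^sub>n\<close>
  say precisely that \<open>C * V = V * D\<close>. Since \<open>V\<close> is invertible, \<open>C\<close> and \<open>D\<close> have the same trace and
  determinant. Those of \<open>D\<close> are the sum of the traces and the product of the determinants of the
  solutions; those of \<open>C\<close> are \<open>- tr A\<^sub>1\<close> and \<open>(-1)\<^bsup>nk\<^esup> det A\<^sub>n\<close>, the latter after moving the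
  first block column to the end.
\<close>

section \<open>Matrices built from square blocks\<close>

text \<open>The layout is that of \<open>block_vandermonde\<close>, with blocks numbered from 0, so
  that the latter becomes an instance.\<close>

definition block_mat :: "nat \<Rightarrow> nat \<Rightarrow> (nat \<Rightarrow> nat \<Rightarrow> 'a mat) \<Rightarrow> 'a mat" where
  "block_mat n k F =
     mat (n * k) (n * k) (\<lambda>(r, c). F (r div k) (c div k) $$ (r mod k, c mod k))"

lemma block_mat_carrier [simp]: "block_mat n k F \<in> carrier_mat (n * k) (n * k)"
  by (simp add: block_mat_def)

lemma div_less_block: "r < n * k \<Longrightarrow> r div k < (n::nat)" "r < n * k \<Longrightarrow> r mod k < (k::nat)"
  by (simp_all add: less_mult_imp_div_less, cases "k = 0", simp_all)

lemma block_index_less: "a < n \<Longrightarrow> r < k \<Longrightarrow> a * k + r < n * (k::nat)"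
proof -
  assume "a < n" "r < k"
  then have "a * k + r < (a + 1) * k" by simp
  also have "\<dots> \<le> n * k" using \<open>a < n\<close> by (intro mult_right_mono) auto
  finally show ?thesis .
qed

lemma block_mat_index:
  assumes "a < n" "b < n" "r < k" "c < k"
  shows "block_mat n k F $$ (a * k + r, b * k + c) = F a b $$ (r, c)"
  using assms by (simp add: block_mat_def block_index_less)

text \<open>Every index splits into a block number and an offset; both matrix products and traces
  are sums of this kind.\<close>

lemma sum_blocks:
  fixes f :: "nat \<Rightarrow> 'a :: comm_monoid_add"
  shows "(\<Sum>i<n * k. f i) = (\<Sum>a<n. \<Sum>r<k. f (a * k + r))"
proof (induction n)
  case (Suc n)
  have "(\<Sum>i<Suc n * k. f i) = (\<Sum>i<n * k. f i) + (\<Sum>i\<in>{n * k..<n * k + k}. f i)"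
    by (simp add: lessThan_atLeast0 sum.atLeastLessThan_concat add.commute)
  also have "(\<Sum>i\<in>{n * k..<n * k + k}. f i) = (\<Sum>r<k. f (n * k + r))"
    using sum.shift_bounds_nat_ivl[of f 0 "n * k" k] by (simp add: lessThan_atLeast0 add.commute)
  finally show ?case using Suc.IH by simp
qed simp

text \<open>Only block entries with both indices below \<open>k\<close> are ever read, so blocks can
  be compared without knowing their dimensions.\<close>

lemma block_mat_cong:
  assumes "\<And>a b r c. a < n \<Longrightarrow> b < n \<Longrightarrow> r < k \<Longrightarrow> c < k \<Longrightarrow> F a b $$ (r, c) = G a b $$ (r, c)"
  shows "block_mat n k F = block_mat n k G"
  unfolding block_mat_def by (rule eq_matI) (auto simp: assms div_less_block)

text \<open>The summation index of an ordinary matrix product is split by \<open>sum_blocks\<close>.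
  The sum over \<open>c\<close> is taken entrywise, because addition on the type of matrices of all
  sizes has no neutral element.\<close>

lemma block_mat_mult:
  assumes "\<And>a b. a < n \<Longrightarrow> b < n \<Longrightarrow> F a b \<in> carrier_mat k k"
    and "\<And>a b. a < n \<Longrightarrow> b < n \<Longrightarrow> G a b \<in> carrier_mat k k"
  shows "block_mat n k F * block_mat n k G =
    block_mat n k (\<lambda>a b. mat k k (\<lambda>rs. \<Sum>c<n. (F a c * G c b) $$ rs))" (is "?L = ?R")
proof (rule eq_matI)
  fix i j assume "i < dim_row ?R" "j < dim_col ?R"
  then have i: "i < n * k" and j: "j < n * k" by (simp_all add: block_mat_def)
  define a r b s where "a = i div k" and "r = i mod k" and "b = j div k" and "s = j mod k"
  have lt: "a < n" "r < k" "b < n" "s < k"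
    using i j by (simp_all add: a_def r_def b_def s_def div_less_block)
  have eq: "i = a * k + r" "j = b * k + s"
    by (simp_all add: a_def r_def b_def s_def)
  have "?L $$ (i, j) = (\<Sum>l<n * k. block_mat n k F $$ (i, l) * block_mat n k G $$ (l, j))"
    using i j by (simp add: scalar_prod_def block_mat_def lessThan_atLeast0)
  also have "\<dots> = (\<Sum>c<n. \<Sum>t<k. F a c $$ (r, t) * G c b $$ (t, s))"
    unfolding sum_blocks eq using lt by (intro sum.cong refl) (simp add: block_mat_index)
  also have "\<dots> = (\<Sum>c<n. (F a c * G c b) $$ (r, s))"
  proof (rule sum.cong[OF refl])
    fix c assume "c \<in> {..<n}"
    then have "F a c \<in> carrier_mat k k" "G c b \<in> carrier_mat k k" using lt assms by auto
    then show "(\<Sum>t<k. F a c $$ (r, t) * G c b $$ (t, s)) = (F a c * G c b) $$ (r, s)"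
      using lt by (simp add: scalar_prod_def lessThan_atLeast0)
  qed
  also have "\<dots> = ?R $$ (i, j)"
    unfolding eq using lt by (simp add: block_mat_index)
  finally show "?L $$ (i, j) = ?R $$ (i, j)" .
qed (simp_all add: block_mat_def)

lemma trace_block_mat:
  assumes "\<And>a. a < n \<Longrightarrow> F a a \<in> carrier_mat k k"
  shows "mat_trace (block_mat n k F) = (\<Sum>a<n. mat_trace (F a a))"
proof -
  have "mat_trace (block_mat n k F) = (\<Sum>i<n * k. block_mat n k F $$ (i, i))"
    by (simp add: mat_trace_def block_mat_def)
  also have "\<dots> = (\<Sum>a<n. mat_trace (F a a))"
    unfolding sum_blocks mat_trace_def
  proof (rule sum.cong[OF refl])
    fix a assume "a \<in> {..<n}"
    then show "(\<Sum>r<k. block_mat n k F $$ (a * k + r, a * k + r)) =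
        (\<Sum>i<dim_row (F a a). F a a $$ (i, i))"
      using assms[of a] by (simp add: block_mat_index)
  qed
  finally show ?thesis .
qed

text \<open>Induction on \<open>n\<close>: splitting off the last diagonal block leaves a two-by-two
  block matrix with zero off-diagonal blocks, whose determinant is a product.\<close>

lemma det_block_diag:
  fixes X :: "nat \<Rightarrow> 'a :: idom mat"
  assumes "\<And>a. a < n \<Longrightarrow> X a \<in> carrier_mat k k"
  shows "det (block_mat n k (\<lambda>a b. if a = b then X b else 0\<^sub>m k k)) = (\<Prod>a<n. det (X a))"
  using assms
proof (induction n)
  case 0
  show ?case by (simp add: block_mat_def)
next
  case (Suc n)
  let ?F = "\<lambda>a b. if a = b then X b else 0\<^sub>m k k"
  have Xn: "X n \<in> carrier_mat k k" using Suc.prems by simp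
  have last: "i div k = n" "i mod k = i - n * k" if "\<not> i < n * k" "i < k + n * k" for i
  proof -
    from that obtain r where "i = n * k + r" "r < k"
      by (metis add.commute add_less_cancel_left le_Suc_ex not_less)
    then show "i div k = n" "i mod k = i - n * k" by simp_all
  qed
  have "block_mat (Suc n) k ?F =
      four_block_mat (block_mat n k ?F) (0\<^sub>m (n * k) k) (0\<^sub>m k (n * k)) (X n)"
  proof (rule eq_matI, goal_cases)
    case (1 i j)
    then have ij: "i < k + n * k" "j < k + n * k" using Xn by (simp_all add: block_mat_def)
    then have k: "k > 0" by (auto intro: gr0I)
    have lt: "l div k < n" if "l < n * k" for l using that by (rule div_less_block)
    show ?case
      using ij Xn k lt[of i] lt[of j] last[of i] last[of j]
      by (cases "i < n * k"; cases "j < n * k") (simp_all add: block_mat_def)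
  qed (use Xn in \<open>simp_all add: block_mat_def\<close>)
  then have "det (block_mat (Suc n) k ?F) = det (block_mat n k ?F) * det (X n)"
    by (simp only: det_four_block_mat_lower_left_zero[OF block_mat_carrier zero_carrier_mat refl Xn])
  then show ?case using Suc by simp
qed

section \<open>The block companion matrix\<close>

text \<open>Applied to the block column of powers of \<open>Y\<close> from 0 to
  \<open>n - 1\<close>, the identities above the diagonal raise each exponent by one, and the last
  block row expresses \<open>Y ^\<^sub>m n\<close> by the equation. For \<open>n = 1\<close> the
  only block is \<open>- A 1\<close>.\<close>

definition companion_blocks ::
    "nat \<Rightarrow> nat \<Rightarrow> (nat \<Rightarrow> 'a :: ring_1 mat) \<Rightarrow> nat \<Rightarrow> nat \<Rightarrow> 'a mat" where
  "companion_blocks n k A a b =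
     (if a = n - 1 then - A (n - b) else if b = a + 1 then 1\<^sub>m k else 0\<^sub>m k k)"

lemma companion_blocks_carrier:
  assumes "\<And>i. i \<in> {1..n} \<Longrightarrow> A i \<in> carrier_mat k k" and "a < n" "b < n"
  shows "companion_blocks n k A a b \<in> carrier_mat k k"
  using assms by (auto simp: companion_blocks_def)

text \<open>The identity blocks lie off the diagonal, so only the last diagonal block
  contributes.\<close>

lemma trace_companion:
  assumes "n \<ge> 1" and A: "\<And>i. i \<in> {1..n} \<Longrightarrow> A i \<in> carrier_mat k k"
  shows "mat_trace (block_mat n k (companion_blocks n k A)) = - mat_trace (A 1)"
proof -
  have A1: "A (Suc 0) \<in> carrier_mat k k" using A[of 1] assms(1) by simp
  have tr: "mat_trace (companion_blocks n k A a a) = (if a = n - 1 then - mat_trace (A 1) else 0)"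
    if "a < n" for a
    using A1 assms(1) by (auto simp: companion_blocks_def mat_trace_def sum_negf)
  have "mat_trace (block_mat n k (companion_blocks n k A)) =
      (\<Sum>a<n. mat_trace (companion_blocks n k A a a))"
    by (rule trace_block_mat) (rule companion_blocks_carrier[OF A])
  also have "\<dots> = (\<Sum>a<n. if a = n - 1 then - mat_trace (A 1) else 0)"
    using tr by (intro sum.cong) auto
  also have "\<dots> = - mat_trace (A 1)" using assms(1) by simp
  finally show ?thesis .
qed

text \<open>Moving the first block column to the end yields a block lower triangular matrix with
  diagonal blocks the identity of size \<open>m * k\<close> and \<open>- A n\<close>, where
  \<open>n = Suc m\<close>. The sign collects the column moves and the negation of
  \<open>A n\<close>.\<close>

lemma det_companion:
  fixes A :: "nat \<Rightarrow> 'a :: idom mat"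
  assumes "n \<ge> 1" and A: "\<And>i. i \<in> {1..n} \<Longrightarrow> A i \<in> carrier_mat k k"
  shows "det (block_mat n k (companion_blocks n k A)) = (-1) ^ (n * k) * det (A n)"
proof -
  obtain m where n: "n = Suc m" using assms(1) by (cases n) auto
  have An: "A n \<in> carrier_mat k k" using A assms(1) by simp
  let ?C = "block_mat n k (companion_blocks n k A)"
  let ?S = "mat (m * k + k) (m * k + k) (\<lambda>(i, j). ?C $$ (i, if j < m * k then j + k else j - m * k))"
  let ?R = "mat k (m * k) (\<lambda>(i, j). ?C $$ (i + m * k, j + k))"
  have C: "?C \<in> carrier_mat (m * k + k) (m * k + k)"
    using block_mat_carrier[of n k] by (simp add: n add.commute)
  have last: "i div k = m" "i mod k = i - m * k" if "\<not> i < m * k" "i < m * k + k" for i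
  proof -
    from that obtain r where "i = m * k + r" "r < k"
      by (metis add_less_cancel_left le_Suc_ex not_less)
    then show "i div k = m" "i mod k = i - m * k" by simp_all
  qed
  have "?S = four_block_mat (1\<^sub>m (m * k)) (0\<^sub>m (m * k) k) ?R (- A n)" (is "_ = ?B")
  proof (rule eq_matI, goal_cases)
    case (1 i j)
    then have ij: "i < m * k + k" "j < m * k + k" using An by simp_all
    then have k: "k > 0" by (auto intro: gr0I)
    show ?case
    proof (cases "i < m * k")
      case True
      then have im: "i div k < m" by (rule div_less_block)
      show ?thesis
      proof (cases "j < m * k")
        case j: True
        \<comment> \<open>The large identity matrix tests \<open>i = j\<close>, whereas the
          companion matrix tests block number and offset separately.\<close>
        have "i = j \<longleftrightarrow> i div k = j div k \<and> i mod k = j mod k"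
          by (metis div_mult_mod_eq)
        then show ?thesis
          using True j im ij An k
          by (auto simp: block_mat_def companion_blocks_def n)
      next
        case j: False
        then have "j - m * k < k" using ij by simp
        then show ?thesis
          using True j im ij An k
          by (auto simp: block_mat_def companion_blocks_def n)
      qed
    next
      case i: False
      note l = last[OF i ij(1)]
      show ?thesis
      proof (cases "j < m * k")
        case True
        then show ?thesis using i ij An k by simp
      next
        case j: False
        then have "j - m * k < k" "i - m * k < k" using ij i by simp_all
        then show ?thesis
          using i j ij An k l by (simp add: block_mat_def companion_blocks_def n)
      qed
    qed
  qed (use An in simp_all)
  moreover have "det ?B = det (- A n)"
    using An by (subst det_four_block_mat_upper_right_zero[where n = "m * k" and m = k]) auto
  moreover have "det (- A n) = (-1) ^ k * det (A n)"
  proof -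
    have "- A n = (-1) \<cdot>\<^sub>m A n" by (rule eq_matI) auto
    then show ?thesis using An by (metis det_smult carrier_matD(2))
  qed
  \<comment> \<open>Each of the first \<open>k\<close> columns passes the \<open>m * k\<close>
    others.\<close>
  moreover have "det ?C = (-1) ^ (m * k * k) * det ?S"
    by (rule det_swap_cols[OF C])
  \<comment> \<open>Both exponents have the same parity, since \<open>k * k\<close> and
    \<open>k\<close> do.\<close>
  moreover have "(-1 :: 'a) ^ (m * k * k) * (-1) ^ k = (-1) ^ (n * k)"
    by (auto simp: n minus_one_power_iff)
  ultimately show ?thesis by (metis mult.assoc)
qed

section \<open>The matrix equation as an intertwining relation\<close>

lemma block_vandermonde_eq_block_mat:
  "block_vandermonde n k X = block_mat n k (\<lambda>a b. X (b + 1) ^\<^sub>m a)"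
  by (simp add: block_vandermonde_def block_mat_def)

text \<open>Reduces the sum in the additive group of matrices to ordinary sums of entries, which the
  block computations use.\<close>

lemma finsum_module_mat:
  fixes f :: "'b \<Rightarrow> 'a :: comm_ring_1 mat"
  assumes "finite S" and "\<And>j. j \<in> S \<Longrightarrow> f j \<in> carrier_mat k l"
  shows "(\<Oplus>\<^bsub>module_mat TYPE('a) k l\<^esub>j\<in>S. f j) = mat k l (\<lambda>rs. \<Sum>j\<in>S. f j $$ rs)"
  using assms
proof (induction S)
  interpret abelian_group "module_mat TYPE('a) k l" by (rule abelian_group_mat)
  case empty
  show ?case by (simp add: module_mat_simps zero_mat_def)
next
  interpret abelian_group "module_mat TYPE('a) k l" by (rule abelian_group_mat)
  case (insert j S)
  have "f \<in> S \<rightarrow> carrier (module_mat TYPE('a) k l)" "f j \<in> carrier (module_mat TYPE('a) k l)"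
    using insert.prems by (auto simp: module_mat_simps)
  then have "(\<Oplus>\<^bsub>module_mat TYPE('a) k l\<^esub>j\<in>insert j S. f j) =
      f j + (\<Oplus>\<^bsub>module_mat TYPE('a) k l\<^esub>j\<in>S. f j)"
    using insert.hyps by (simp add: finsum_insert) (simp add: module_mat_simps)
  also have "\<dots> = f j + mat k l (\<lambda>rs. \<Sum>j\<in>S. f j $$ rs)"
    using insert by simp
  also have "\<dots> = mat k l (\<lambda>rs. \<Sum>j\<in>insert j S. f j $$ rs)"
    using insert.hyps insert.prems[of j] by (intro eq_matI) auto
  finally show ?case .
qed

text \<open>The equation solved for its leading power and reindexed by \<open>c = n - j\<close>:
  this is the last block row of the companion matrix applied to the powers of
  \<open>Y\<close>.\<close>

lemma solves_matrix_equation_index: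
  assumes A: "\<And>i. i \<in> {1..n} \<Longrightarrow> A i \<in> carrier_mat k k" and Y: "Y \<in> carrier_mat k k"
    and sol: "solves_matrix_equation n k A Y" and rs: "r < k" "s < k"
  shows "(\<Sum>c<n. (- A (n - c) * Y ^\<^sub>m c) $$ (r, s)) = (Y ^\<^sub>m n) $$ (r, s)"
proof -
  have AY: "A j * Y ^\<^sub>m (n - j) \<in> carrier_mat k k" if "j \<in> {1..n}" for j
    using A[OF that] Y by (auto intro: mult_carrier_mat pow_carrier_mat)
  have "(Y ^\<^sub>m n + mat k k (\<lambda>rs. \<Sum>j\<in>{1..n}. (A j * Y ^\<^sub>m (n - j)) $$ rs)) $$ (r, s) = 0"
    using sol rs unfolding solves_matrix_equation_def
    by (subst (asm) finsum_module_mat[OF finite_atLeastAtMost AY]) simp_all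
  then have "(Y ^\<^sub>m n) $$ (r, s) = - (\<Sum>j\<in>{1..n}. (A j * Y ^\<^sub>m (n - j)) $$ (r, s))"
    using rs by (simp add: eq_neg_iff_add_eq_0)
  also have "(\<Sum>j\<in>{1..n}. (A j * Y ^\<^sub>m (n - j)) $$ (r, s)) =
      (\<Sum>c<n. (A (n - c) * Y ^\<^sub>m c) $$ (r, s))"
    by (rule sum.reindex_bij_witness[of _ "\<lambda>c. n - c" "\<lambda>j. n - j"]) auto
  also have "- \<dots> = (\<Sum>c<n. (- A (n - c) * Y ^\<^sub>m c) $$ (r, s))"
    unfolding sum_negf[symmetric]
  proof (rule sum.cong[OF refl])
    fix c assume "c \<in> {..<n}"
    then have "A (n - c) \<in> carrier_mat k k" using A by simp
    moreover have "Y ^\<^sub>m c \<in> carrier_mat k k" using Y by (rule pow_carrier_mat)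
    ultimately have dims: "dim_row (A (n - c)) = k" "dim_col (A (n - c)) = dim_row (Y ^\<^sub>m c)"
        "dim_col (Y ^\<^sub>m c) = k" by (auto simp only: carrier_matD)
    show "- ((A (n - c) * Y ^\<^sub>m c) $$ (r, s)) = (- A (n - c) * Y ^\<^sub>m c) $$ (r, s)"
      unfolding uminus_mult_left_mat[OF dims(2)] using rs dims
      by (simp only: index_uminus_mat index_mult_mat(2,3))
  qed
  finally show ?thesis by simp
qed

text \<open>On both sides the block at \<open>(a, b)\<close> is
  \<open>X (b + 1) ^\<^sub>m Suc a\<close>. On the left this is the shift of powers, or the matrix
  equation in the last block row; on the right each block column is multiplied by its own
  solution.\<close>

lemma companion_mult_vandermonde:
  fixes X :: "nat \<Rightarrow> complex mat"
  assumes A: "\<And>i. i \<in> {1..n} \<Longrightarrow> A i \<in> carrier_mat k k"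
    and X: "\<And>i. i \<in> {1..n} \<Longrightarrow> X i \<in> carrier_mat k k"
    and sol: "\<And>i. i \<in> {1..n} \<Longrightarrow> solves_matrix_equation n k A (X i)"
  shows "block_mat n k (companion_blocks n k A) * block_vandermonde n k X =
    block_vandermonde n k X * block_mat n k (\<lambda>a b. if a = b then X (b + 1) else 0\<^sub>m k k)"
proof -
  have Xb: "X (b + 1) \<in> carrier_mat k k" if "b < n" for b using X that by simp
  have pw: "X (b + 1) ^\<^sub>m a \<in> carrier_mat k k" if "b < n" for a b
    using Xb[OF that] by (rule pow_carrier_mat)
  have L: "(\<Sum>c<n. (companion_blocks n k A a c * X (b + 1) ^\<^sub>m c) $$ (r, s)) =
      (X (b + 1) ^\<^sub>m Suc a) $$ (r, s)" if "a < n" "b < n" "r < k" "s < k" for a b r s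
  proof (cases "a = n - 1")
    \<comment> \<open>Here \<open>Suc a = n\<close>, so the claim is the matrix equation for
      \<open>X (b + 1)\<close>.\<close>
    case True
    then show ?thesis
      using solves_matrix_equation_index[OF A Xb sol, of b r s] that
      by (simp add: companion_blocks_def)
  next
    case False
    \<comment> \<open>Only the identity block at \<open>c = Suc a\<close> survives, and this index
      is below \<open>n\<close> because the row is not the last. Powers stay folded so that both
      sides match.\<close>
    have "(\<Sum>c<n. (companion_blocks n k A a c * X (b + 1) ^\<^sub>m c) $$ (r, s)) =
        (\<Sum>c<n. if c = Suc a then (X (b + 1) ^\<^sub>m c) $$ (r, s) else 0)"
      using False that left_mult_one_mat[OF pw[OF that(2)]] left_mult_zero_mat[OF pw[OF that(2)]]
      by (intro sum.cong refl) (auto simp: companion_blocks_def simp del: pow_mat.simps)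
    also have "\<dots> = (X (b + 1) ^\<^sub>m Suc a) $$ (r, s)"
      using False that by (simp del: pow_mat.simps)
    finally show ?thesis .
  qed
  have R: "(\<Sum>c<n. (X (c + 1) ^\<^sub>m a * (if c = b then X (b + 1) else 0\<^sub>m k k)) $$ (r, s)) =
      (X (b + 1) ^\<^sub>m Suc a) $$ (r, s)" if "a < n" "b < n" "r < k" "s < k" for a b r s
  proof -
    have "(\<Sum>c<n. (X (c + 1) ^\<^sub>m a * (if c = b then X (b + 1) else 0\<^sub>m k k)) $$ (r, s)) =
        (\<Sum>c<n. if c = b then (X (b + 1) ^\<^sub>m Suc a) $$ (r, s) else 0)"
    proof (rule sum.cong[OF refl])
      fix c assume "c \<in> {..<n}"
      then have "X (c + 1) ^\<^sub>m a \<in> carrier_mat k k" by (intro pw) simp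
      then show "(X (c + 1) ^\<^sub>m a * (if c = b then X (b + 1) else 0\<^sub>m k k)) $$ (r, s) =
          (if c = b then (X (b + 1) ^\<^sub>m Suc a) $$ (r, s) else 0)"
        using that right_mult_zero_mat[of "X (c + 1) ^\<^sub>m a" k k k] by auto
    qed
    then show ?thesis using that by simp
  qed
  have "block_mat n k (companion_blocks n k A) * block_vandermonde n k X =
      block_mat n k (\<lambda>a b. X (b + 1) ^\<^sub>m Suc a)"
    unfolding block_vandermonde_eq_block_mat
    by (subst block_mat_mult[OF companion_blocks_carrier[OF A] pw])
      (assumption | rule block_mat_cong | simp only: index_mat case_prod_conv L)+
  also have "\<dots> = block_vandermonde n k X *
      block_mat n k (\<lambda>a b. if a = b then X (b + 1) else 0\<^sub>m k k)"
    unfolding block_vandermonde_eq_block_mat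
    by (subst block_mat_mult[OF pw])
      (assumption | rule block_mat_cong | simp only: index_mat case_prod_conv R | use Xb in simp)+
  finally show ?thesis .
qed

section \<open>Invariance of trace and determinant\<close>

lemma mat_trace_mult_commute:
  fixes B C :: "'a :: comm_semiring_0 mat"
  assumes "B \<in> carrier_mat n m" "C \<in> carrier_mat m n"
  shows "mat_trace (B * C) = mat_trace (C * B)"
proof -
  have "mat_trace (B * C) = (\<Sum>i<n. \<Sum>j<m. B $$ (i, j) * C $$ (j, i))"
    using assms by (simp add: mat_trace_def scalar_prod_def lessThan_atLeast0)
  also have "\<dots> = (\<Sum>j<m. \<Sum>i<n. C $$ (j, i) * B $$ (i, j))"
    by (subst sum.swap) (simp add: mult.commute)
  also have "\<dots> = mat_trace (C * B)"
    using assms by (simp add: mat_trace_def scalar_prod_def lessThan_atLeast0)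
  finally show ?thesis .
qed

text \<open>As \<open>V\<close> is invertible, \<open>C\<close> and \<open>D\<close> are similar.
  The trace follows by commuting factors, the determinant by cancelling
  \<open>det V\<close>.\<close>

lemma intertwined_trace_det:
  fixes C D V :: "'a :: field mat"
  assumes C: "C \<in> carrier_mat n n" and D: "D \<in> carrier_mat n n" and V: "V \<in> carrier_mat n n"
    and "det V \<noteq> 0" and eq: "C * V = V * D"
  shows "mat_trace C = mat_trace D" "det C = det D"
proof -
  obtain W where W: "W \<in> carrier_mat n n" and "V * W = 1\<^sub>m n" and "W * V = 1\<^sub>m n"
    \<comment> \<open>The argument \<open>()\<close> fills the extension field of the ring
      record.\<close>
    using det_non_zero_imp_unit[OF V \<open>det V \<noteq> 0\<close>, of "()"]
    by (auto simp: Units_def ring_mat_def)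
  have "mat_trace C = mat_trace (C * (V * W))" using C \<open>V * W = 1\<^sub>m n\<close> by simp
  also have "C * (V * W) = (V * D) * W" using C V W eq by (simp flip: assoc_mult_mat)
  also have "mat_trace \<dots> = mat_trace (W * (V * D))"
    using V D W by (intro mat_trace_mult_commute) auto
  also have "W * (V * D) = D" using V D W \<open>W * V = 1\<^sub>m n\<close> by (simp flip: assoc_mult_mat)
  finally show "mat_trace C = mat_trace D" .
  have "det C * det V = det V * det D"
    using eq det_mult[OF C V] det_mult[OF V D] by metis
  then show "det C = det D" using \<open>det V \<noteq> 0\<close> by auto
qed

theorem theorem1p1:
  fixes n k :: nat and A X :: "nat \<Rightarrow> complex mat"
  assumes "n \<ge> 1" and "k \<ge> 1"
    and "\<And>i. i \<in> {1..n} \<Longrightarrow> A i \<in> carrier_mat k k"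
    and "\<And>i. i \<in> {1..n} \<Longrightarrow> X i \<in> carrier_mat k k"
    and "independent_mats n k X"
    and "\<And>i. i \<in> {1..n} \<Longrightarrow> solves_matrix_equation n k A (X i)"
  shows "mat_trace (A 1) = - (\<Sum>i\<in>{1..n}. mat_trace (X i)) \<and>
    det (A n) = (-1) ^ (n * k) * (\<Prod>i\<in>{1..n}. det (X i))"
proof -
  let ?C = "block_mat n k (companion_blocks n k A)"
  let ?D = "block_mat n k (\<lambda>a b. if a = b then X (b + 1) else 0\<^sub>m k k)"
  let ?V = "block_vandermonde n k X"
  have X: "X (a + 1) \<in> carrier_mat k k" if "a < n" for a using assms(4) that by simp
  have V: "?V \<in> carrier_mat (n * k) (n * k)" by (simp add: block_vandermonde_eq_block_mat)
  note CD = intertwined_trace_det[OF block_mat_carrier block_mat_carrier V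
      assms(5)[unfolded independent_mats_def] companion_mult_vandermonde[OF assms(3,4,6)]]
  have "- mat_trace (A 1) = (\<Sum>a<n. mat_trace (X (a + 1)))"
    using CD(1) trace_companion[OF assms(1,3)] X
      trace_block_mat[of n "\<lambda>a b. if a = b then X (b + 1) else 0\<^sub>m k k" k] by simp
  also have "\<dots> = (\<Sum>i\<in>{1..n}. mat_trace (X i))"
    by (rule sum.reindex_bij_witness[of _ "\<lambda>i. i - 1" "\<lambda>a. a + 1"]) auto
  finally have trace: "mat_trace (A 1) = - (\<Sum>i\<in>{1..n}. mat_trace (X i))"
    by (metis minus_minus)
  have "(-1) ^ (n * k) * det (A n) = (\<Prod>a<n. det (X (a + 1)))"
    using CD(2) det_companion[OF assms(1,3)] det_block_diag[of n "\<lambda>a. X (a + 1)" k, OF X] by simp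
  also have "\<dots> = (\<Prod>i\<in>{1..n}. det (X i))"
    by (rule prod.reindex_bij_witness[of _ "\<lambda>i. i - 1" "\<lambda>a. a + 1"]) auto
  \<comment> \<open>The sign squares to 1, so multiplying by it once more moves it to the other
    side.\<close>
  finally have "(-1) ^ (n * k) * ((-1) ^ (n * k) * det (A n)) =
      (-1) ^ (n * k) * (\<Prod>i\<in>{1..n}. det (X i))"
    by simp
  then have "det (A n) = (-1) ^ (n * k) * (\<Prod>i\<in>{1..n}. det (X i))"
    by (simp flip: mult.assoc power_mult_distrib)
  with trace show ?thesis by blast
qed

end
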